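(* Let $G$ be a graph with no infinite clique. Then the neighborhood lattice $\widehat{N(G)}$ contains an infinite chain if and only if $G$ contains an induced subgraph isomorphic to $G_0$ or to $G_1$.
   Context: Graphs are undirected, simple and without loops (possibly infinite). For a graph $G=(V,\mathcal E)$ and $x\in V$, $N_G(x)=\{y\in V:\{x,y\}\in\mathcal E\}$. The neighborhood lattice $\widehat{N(G)}$ is the set of all intersections of subfamilies of $\{N_G(x): x\in V\}$ (with the intersection of the empty family equal to $V$), ordered by inclusion; it is a complete lattice. The graphs $G_0,G_1$ have vertex set $A\cup B$ where $A=\{a_i: i\in\mathbb N\}$ and $B=\{b_i: i\in\mathbb N\}$ are disjoint independent sets (all listed vertices distinct). The edges of $G_0$ are the pairs $\{a_i,b_j\}$ with $i\neq j$; the edges of $G_1$ are the pairs $\{a_i,b_j\}$ with $i\le j$. *)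

theory Defs
  imports Main
begin

text \<open>A graph is a pair of a vertex set and an edge set, an edge being an unordered pair
  of distinct vertices, represented as a two-element set.\<close>

type_synonym 'a ugraph = "'a set \<times> 'a set set"

abbreviation verts :: "'a ugraph \<Rightarrow> 'a set" where "verts G \<equiv> fst G"

abbreviation edges :: "'a ugraph \<Rightarrow> 'a set set" where "edges G \<equiv> snd G"

definition simple_graph :: "'a ugraph \<Rightarrow> bool" where
  "simple_graph G \<longleftrightarrow> edges G \<subseteq> {{x, y} | x y. x \<in> verts G \<and> y \<in> verts G \<and> x \<noteq> y}"

definition neighborhood :: "'a ugraph \<Rightarrow> 'a \<Rightarrow> 'a set" where
  "neighborhood G x = {y \<in> verts G. {x, y} \<in> edges G}"

text \<open>Intersecting with the vertex set only matters for the empty family, whose intersection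
  is by convention the vertex set; in Isabelle/HOL it would be \<^term>\<open>UNIV\<close>. The order is
  set inclusion.\<close>

definition neighborhood_lattice :: "'a ugraph \<Rightarrow> 'a set set" where
  "neighborhood_lattice G = {verts G \<inter> \<Inter>\<F> | \<F>. \<F> \<subseteq> neighborhood G ` verts G}"

definition clique :: "'a ugraph \<Rightarrow> 'a set \<Rightarrow> bool" where
  "clique G K \<longleftrightarrow> K \<subseteq> verts G \<and> (\<forall>x\<in>K. \<forall>y\<in>K. x \<noteq> y \<longrightarrow> {x, y} \<in> edges G)"

definition induced_subgraph :: "'a ugraph \<Rightarrow> 'a set \<Rightarrow> 'a ugraph" where
  "induced_subgraph G U = (U, {e \<in> edges G. e \<subseteq> U})"

definition graph_isomorphic :: "'a ugraph \<Rightarrow> 'b ugraph \<Rightarrow> bool" where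
  "graph_isomorphic G H \<longleftrightarrow>
     (\<exists>f. bij_betw f (verts G) (verts H) \<and>
          (\<forall>x\<in>verts G. \<forall>y\<in>verts G. {x, y} \<in> edges G \<longleftrightarrow> {f x, f y} \<in> edges H))"

definition has_induced_copy :: "'a ugraph \<Rightarrow> 'b ugraph \<Rightarrow> bool" where
  "has_induced_copy G H \<longleftrightarrow> (\<exists>U \<subseteq> verts G. graph_isomorphic (induced_subgraph G U) H)"

text \<open>The vertex \<open>a\<^sub>i\<close> is \<^term>\<open>Inl i\<close> and the vertex \<open>b\<^sub>j\<close> is \<^term>\<open>Inr j\<close>.\<close>

definition G0 :: "(nat + nat) ugraph" where
  "G0 = (range Inl \<union> range Inr, {{Inl i, Inr j} | i j. i \<noteq> j})"

definition G1 :: "(nat + nat) ugraph" where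
  "G1 = (range Inl \<union> range Inr, {{Inl i, Inr j} | i j. i \<le> j})"

lemma simple_graph_G0: "simple_graph G0"
  unfolding simple_graph_def G0_def by fastforce

lemma simple_graph_G1: "simple_graph G1"
  unfolding simple_graph_def G1_def by fastforce

end

theory Submission
  imports "HOL-Library.Ramsey" Defs
begin

text \<open>A strictly increasing sequence \<open>X\<^sub>n\<close> of members of the lattice yields vertices
  \<open>x\<^sub>n \<in> X\<^sub>n\<^sub>+\<^sub>1 - X\<^sub>n\<close> and \<open>y\<^sub>n\<close> with \<open>X\<^sub>n \<subseteq> N(y\<^sub>n)\<close> and \<open>x\<^sub>n \<notin> N(y\<^sub>n)\<close>; hence \<open>x\<^sub>m\<close> is adjacent to \<open>y\<^sub>n\<close>
  for \<open>m < n\<close> but not for \<open>m = n\<close>. A strictly decreasing sequence gives the same pattern with the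
  roles of \<open>x\<close> and \<open>y\<close> exchanged. By Ramsey's theorem and the absence of infinite cliques one may
  assume that the \<open>x\<^sub>n\<close> and the \<open>y\<^sub>n\<close> are independent, and that the adjacency of \<open>x\<^sub>n\<close> and \<open>y\<^sub>m\<close>
  for \<open>m < n\<close> is constant: this is \<open>G\<^sub>0\<close> or, after shifting \<open>y\<close> by one, \<open>G\<^sub>1\<close>. Conversely, in
  both graphs the intersections \<open>\<Inter>\<^sub>i\<^sub><\<^sub>n N(a\<^sub>i)\<close> form an infinite chain, since \<open>b\<^sub>n\<close> lies in the
  \<open>n\<close>-th but not in the \<open>(n + 2)\<close>-nd of them.\<close>

section \<open>Ramsey's theorem for sequences\<close>

lemma Ramsey_subsequence:
  fixes P :: "nat \<Rightarrow> nat \<Rightarrow> bool"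
  obtains r :: "nat \<Rightarrow> nat" where "strict_mono r"
    and "(\<forall>m n. m < n \<longrightarrow> P (r m) (r n)) \<or> (\<forall>m n. m < n \<longrightarrow> \<not> P (r m) (r n))"
proof -
  \<comment> \<open>The colouring in \<open>Ramsey2\<close> is evaluated on unordered pairs;
    \<open>Min\<close> and \<open>Max\<close> recover the order, so \<open>P\<close> may be
    asymmetric.\<close>
  define f :: "nat set \<Rightarrow> nat" where "f = (\<lambda>S. if P (Min S) (Max S) then 1 else 0)"
  have "\<exists>Y t. Y \<subseteq> UNIV \<and> infinite Y \<and> t < 2 \<and> (\<forall>x\<in>Y. \<forall>y\<in>Y. x \<noteq> y \<longrightarrow> f {x, y} = t)"
    by (rule Ramsey2) (auto simp: f_def)
  then obtain Y t where Y: "infinite Y" and t: "\<forall>x\<in>Y. \<forall>y\<in>Y. x \<noteq> y \<longrightarrow> f {x, y} = t"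
    by (elim exE conjE)
  define r where "r = enumerate Y"
  have mono: "strict_mono r"
    unfolding r_def by (rule strict_mono_enumerate[OF Y])
  have "P (r m) (r n) \<longleftrightarrow> t = 1" if "m < n" for m n
  proof -
    have less: "r m < r n"
      using mono that by (simp add: strict_monoD)
    moreover have "r m \<in> Y" "r n \<in> Y"
      using Y by (simp_all add: r_def enumerate_in_set)
    then have "f {r m, r n} = t"
      using t less by simp
    ultimately show ?thesis
      by (auto simp: f_def split: if_splits)
  qed
  then show thesis
    using that[OF mono] by blast
qed

text \<open>Ramsey is applied to strict inclusion along an injective sequence in \<open>C\<close>.
  Since members of a chain are comparable, failure of strict inclusion at all pairs means strict
  descent.\<close>

lemma infinite_chain_obtains_strict_sequence:
  assumes "C \<in> chains L" and "infinite C"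
  obtains X :: "nat \<Rightarrow> 'a set" where "range X \<subseteq> L" and "strict_mono X"
  | X :: "nat \<Rightarrow> 'a set" where "range X \<subseteq> L" and "\<And>m n. m < n \<Longrightarrow> X n \<subset> X m"
proof -
  obtain f :: "nat \<Rightarrow> 'a set" where f: "inj f" "range f \<subseteq> C"
    using assms(2) infinite_countable_subset by blast
  obtain r :: "nat \<Rightarrow> nat" where r: "strict_mono r"
    and hom: "(\<forall>m n. m < n \<longrightarrow> f (r m) \<subset> f (r n)) \<or> (\<forall>m n. m < n \<longrightarrow> \<not> f (r m) \<subset> f (r n))"
    by (rule Ramsey_subsequence)
  have L: "range (f \<circ> r) \<subseteq> L"
    using f(2) assms(1) by (auto simp: chains_def)
  have less: "f (r n) \<subset> f (r m)" if "m < n" "\<not> f (r m) \<subset> f (r n)" for m n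
  proof -
    have "f (r m) \<noteq> f (r n)"
      using f(1) r that(1) by (metis injD less_irrefl strict_monoD)
    moreover have "f (r m) \<subseteq> f (r n) \<or> f (r n) \<subseteq> f (r m)"
    proof -
      have "f (r m) \<in> C" "f (r n) \<in> C"
        using f(2) by auto
      then show ?thesis
        using assms(1) unfolding chains_def chain_subset_def by blast
    qed
    ultimately show ?thesis
      using that(2) by blast
  qed
  from hom show thesis
  proof
    assume "\<forall>m n. m < n \<longrightarrow> f (r m) \<subset> f (r n)"
    then show thesis
      using that(1)[OF L] by (simp add: strict_mono_def)
  next
    assume "\<forall>m n. m < n \<longrightarrow> \<not> f (r m) \<subset> f (r n)"
    then show thesis
      using that(2)[OF L] less by simp
  qed
qed

section \<open>Bipartite graphs and their induced copies\<close>

definition bipartite_graph :: "(nat \<Rightarrow> nat \<Rightarrow> bool) \<Rightarrow> (nat + nat) ugraph" where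
  "bipartite_graph R = (range Inl \<union> range Inr, {{Inl i, Inr j} | i j. R i j})"

lemma G0_eq_bipartite_graph: "G0 = bipartite_graph (\<noteq>)"
  and G1_eq_bipartite_graph: "G1 = bipartite_graph (\<le>)"
  by (simp_all add: G0_def G1_def bipartite_graph_def)

lemma verts_bipartite_graph: "verts (bipartite_graph R) = UNIV"
  by (simp add: bipartite_graph_def flip: UNIV_sum)

lemma edges_bipartite_graph:
  "{Inl i, Inl i'} \<notin> edges (bipartite_graph R)"
  "{Inr j, Inr j'} \<notin> edges (bipartite_graph R)"
  "{Inl i, Inr j} \<in> edges (bipartite_graph R) \<longleftrightarrow> R i j"
  "{Inr j, Inl i} \<in> edges (bipartite_graph R) \<longleftrightarrow> R i j"
  by (auto simp: bipartite_graph_def doubleton_eq_iff)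

text \<open>\<open>graph_isomorphic\<close> maps the subgraph of \<open>G\<close> onto
  \<open>H\<close>. Its inverse is an embedding of \<open>H\<close> into \<open>G\<close>, which is
  easier to construct and to use, and whose image replaces the set \<open>U\<close>.\<close>

lemma has_induced_copy_iff_embedding:
  "has_induced_copy G H \<longleftrightarrow>
    (\<exists>g. inj_on g (verts H) \<and> g ` verts H \<subseteq> verts G \<and>
      (\<forall>x\<in>verts H. \<forall>y\<in>verts H. {g x, g y} \<in> edges G \<longleftrightarrow> {x, y} \<in> edges H))"
proof
  assume "has_induced_copy G H"
  then obtain U f where U: "U \<subseteq> verts G" and f: "bij_betw f U (verts H)"
    and E: "\<And>x y. x \<in> U \<Longrightarrow> y \<in> U \<Longrightarrow> {x, y} \<in> edges G \<longleftrightarrow> {f x, f y} \<in> edges H"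
    unfolding has_induced_copy_def graph_isomorphic_def induced_subgraph_def by auto
  define g where "g = inv_into U f"
  have g: "bij_betw g (verts H) U"
    unfolding g_def by (rule bij_betw_inv_into[OF f])
  have fg: "f (g x) = x" if "x \<in> verts H" for x
    unfolding g_def using f that by (rule bij_betw_inv_into_right)
  have "{g x, g y} \<in> edges G \<longleftrightarrow> {x, y} \<in> edges H" if "x \<in> verts H" "y \<in> verts H" for x y
    using E[of "g x" "g y"] fg g that by (auto simp: bij_betw_def)
  then show "\<exists>g. inj_on g (verts H) \<and> g ` verts H \<subseteq> verts G \<and>
      (\<forall>x\<in>verts H. \<forall>y\<in>verts H. {g x, g y} \<in> edges G \<longleftrightarrow> {x, y} \<in> edges H)"
    using g U by (auto simp: bij_betw_def)
next
  assume "\<exists>g. inj_on g (verts H) \<and> g ` verts H \<subseteq> verts G \<and>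
      (\<forall>x\<in>verts H. \<forall>y\<in>verts H. {g x, g y} \<in> edges G \<longleftrightarrow> {x, y} \<in> edges H)"
  then obtain g where inj: "inj_on g (verts H)" and sub: "g ` verts H \<subseteq> verts G"
    and E: "\<forall>x\<in>verts H. \<forall>y\<in>verts H. {g x, g y} \<in> edges G \<longleftrightarrow> {x, y} \<in> edges H"
    by (elim exE conjE)
  define f where "f = inv_into (verts H) g"
  have "bij_betw f (g ` verts H) (verts H)"
    unfolding f_def by (rule bij_betw_inv_into[OF inj_on_imp_bij_betw[OF inj]])
  moreover have "f (g x) = x" if "x \<in> verts H" for x
    unfolding f_def using inj that by (rule inv_into_f_f)
  ultimately have "graph_isomorphic (induced_subgraph G (g ` verts H)) H"
    unfolding graph_isomorphic_def induced_subgraph_def using E by (intro exI[of _ f]) auto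
  then show "has_induced_copy G H"
    unfolding has_induced_copy_def using sub by blast
qed

lemma has_induced_copy_bipartite_graphI:
  assumes "inj a" "inj b" "\<And>i j. a i \<noteq> b j" "range a \<subseteq> verts G" "range b \<subseteq> verts G"
    and "\<And>i j. {a i, a j} \<notin> edges G" "\<And>i j. {b i, b j} \<notin> edges G"
    and "\<And>i j. {a i, b j} \<in> edges G \<longleftrightarrow> R i j"
  shows "has_induced_copy G (bipartite_graph R)"
  unfolding has_induced_copy_iff_embedding verts_bipartite_graph
proof (intro exI[of _ "case_sum a b"] conjI ballI)
  show "inj (case_sum a b)"
  proof (rule injI)
    show "x = y" if "case_sum a b x = case_sum a b y" for x y
      using that assms(1-3) assms(3)[symmetric] by (cases x; cases y) (simp_all add: inj_eq)
  qed
  show "range (case_sum a b) \<subseteq> verts G"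
    using assms(4,5) by (auto simp: image_subset_iff split: sum.splits)
  have "{b j, a i} \<in> edges G \<longleftrightarrow> R i j" for i j
    by (subst insert_commute) (rule assms(8))
  with assms(6-8) show "{case_sum a b x, case_sum a b y} \<in> edges G \<longleftrightarrow> {x, y} \<in> edges (bipartite_graph R)" for x y
    by (cases x; cases y) (simp_all add: edges_bipartite_graph)
qed

lemma has_induced_copy_bipartite_graphE:
  assumes "has_induced_copy G (bipartite_graph R)"
  obtains a b where "range a \<subseteq> verts G" "range b \<subseteq> verts G"
    and "\<And>i j. {a i, b j} \<in> edges G \<longleftrightarrow> R i j"
proof -
  obtain g where g: "range g \<subseteq> verts G"
    and E: "\<And>x y. {g x, g y} \<in> edges G \<longleftrightarrow> {x, y} \<in> edges (bipartite_graph R)"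
    using assms by (auto simp: has_induced_copy_iff_embedding verts_bipartite_graph)
  show thesis
  proof (rule that)
    show "range (g \<circ> Inl) \<subseteq> verts G" "range (g \<circ> Inr) \<subseteq> verts G"
      using g by auto
    show "{(g \<circ> Inl) i, (g \<circ> Inr) j} \<in> edges G \<longleftrightarrow> R i j" for i j
      by (simp add: E edges_bipartite_graph)
  qed
qed

section \<open>From an induced copy to an infinite chain\<close>

text \<open>The two conditions on \<open>R\<close> isolate what \<noteq> and \<le> share:
  \<open>less\<close> puts \<open>b n\<close> into the intersection of the first \<open>n\<close>
  neighborhoods, and \<open>not_R\<close> removes it after at most two more.\<close>

lemma infinite_chain_of_bipartite_graph:
  assumes "has_induced_copy G (bipartite_graph R)"
    and less: "\<And>i n. i < n \<Longrightarrow> R i n" and not_R: "\<And>n. \<exists>i < n + 2. \<not> R i n"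
  shows "\<exists>C \<in> chains (neighborhood_lattice G). infinite C"
proof -
  obtain a b where a: "range a \<subseteq> verts G" and b: "range b \<subseteq> verts G"
    and E: "\<And>i j. {a i, b j} \<in> edges G \<longleftrightarrow> R i j"
    using assms(1) by (elim has_induced_copy_bipartite_graphE) blast
  define P where "P n = verts G \<inter> \<Inter> (neighborhood G ` a ` {..<n})" for n :: nat
  have anti: "P n \<subseteq> P m" if "m \<le> n" for m n
    unfolding P_def using that by auto
  have mem: "b j \<in> P n \<longleftrightarrow> (\<forall>i<n. R i j)" for j n
    using b by (auto simp: P_def neighborhood_def E)
  have "P n \<noteq> P m" if "m + 2 \<le> n" for m n
  proof -
    have "b m \<in> P m" "b m \<notin> P (m + 2)"
      unfolding mem using less not_R by auto
    then show ?thesis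
      using anti[OF that] by blast
  qed
  \<comment> \<open>Sets are known to differ only when their indices are at least two apart, hence
    the restriction to even indices.\<close>
  then have "inj (\<lambda>n. P (2 * n))"
    by (intro linorder_inj_onI') (metis Suc_leI mult_Suc_right mult_le_mono2 add.commute)
  then have inf: "infinite (range (\<lambda>n. P (2 * n)))"
    by (rule range_inj_infinite)
  have "P n \<in> neighborhood_lattice G" for n
    unfolding neighborhood_lattice_def P_def using a by blast
  moreover have "P m \<subseteq> P n \<or> P n \<subseteq> P m" for m n
    using anti nat_le_linear by blast
  ultimately have "range (\<lambda>n. P (2 * n)) \<in> chains (neighborhood_lattice G)"
    by (simp add: chains_def chain_subset_def image_subset_iff)
  with inf show ?thesis
    by blast
qed

section \<open>From an infinite chain to an induced copy\<close>

text \<open>Some neighborhood in a family with intersection \<open>X\<close> must omit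
  \<open>x\<close>; its centre is \<open>y\<close>. As \<open>x\<close> is a vertex, it cannot be
  missing from \<open>X\<close> merely because of the intersection with
  \<open>verts G\<close>.\<close>

lemma neighborhood_lattice_separate:
  assumes "X \<in> neighborhood_lattice G" and "x \<in> verts G" and "x \<notin> X"
  obtains y where "y \<in> verts G" and "\<And>z. z \<in> X \<Longrightarrow> {z, y} \<in> edges G" and "{x, y} \<notin> edges G"
proof -
  obtain F where F: "F \<subseteq> neighborhood G ` verts G" "X = verts G \<inter> \<Inter>F"
    using assms(1) unfolding neighborhood_lattice_def by blast
  then obtain y where y: "y \<in> verts G" "neighborhood G y \<in> F" "x \<notin> neighborhood G y"
    using assms(2,3) by blast
  show thesis
  proof (rule that[OF y(1)])
    show "{z, y} \<in> edges G" if "z \<in> X" for z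
      using that F(2) y(2) by (auto simp: neighborhood_def insert_commute)
    show "{x, y} \<notin> edges G"
      using assms(2) y(3) by (simp add: neighborhood_def insert_commute)
  qed
qed

lemma infinite_chain_half_graph:
  assumes "C \<in> chains (neighborhood_lattice G)" and "infinite C"
  obtains x y :: "nat \<Rightarrow> 'a" where "range x \<subseteq> verts G" and "range y \<subseteq> verts G"
    and "\<And>m n. m < n \<Longrightarrow> {x m, y n} \<in> edges G" and "\<And>n. {x n, y n} \<notin> edges G"
  using assms
proof (cases rule: infinite_chain_obtains_strict_sequence)
  case (1 X)
  have "\<exists>x y. x \<in> verts G \<and> y \<in> verts G \<and> x \<in> X (Suc n) \<and>
      (\<forall>z\<in>X n. {z, y} \<in> edges G) \<and> {x, y} \<notin> edges G" for n
  proof -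
    obtain x where x: "x \<in> X (Suc n)" "x \<notin> X n"
      using strict_monoD[OF 1(2), of n "Suc n"] by blast
    moreover have "x \<in> verts G"
      using x(1) 1(1) unfolding neighborhood_lattice_def by blast
    moreover obtain y where "y \<in> verts G" "\<And>z. z \<in> X n \<Longrightarrow> {z, y} \<in> edges G" "{x, y} \<notin> edges G"
      using neighborhood_lattice_separate[of "X n" G x] 1(1) x(2) \<open>x \<in> verts G\<close> by blast
    ultimately show ?thesis
      by blast
  qed
  then obtain x y where xy: "\<And>n. x n \<in> verts G \<and> y n \<in> verts G \<and> x n \<in> X (Suc n) \<and>
      (\<forall>z\<in>X n. {z, y n} \<in> edges G) \<and> {x n, y n} \<notin> edges G"
    by metis
  \<comment> \<open>From \<open>m < n\<close> follows \<open>Suc m \<le> n\<close>, so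
    \<open>x m\<close> lies in \<open>X (Suc m)\<close>, a subset of \<open>X n\<close>, all of
    whose elements are adjacent to \<open>y n\<close>.\<close>
  have "{x m, y n} \<in> edges G" if "m < n" for m n
    using xy[of m] xy[of n] strict_mono_less_eq[OF 1(2), of "Suc m" n] that by auto
  then show thesis
    using that[of x y] xy by blast
next
  case (2 X)
  have "\<exists>x y. x \<in> verts G \<and> y \<in> verts G \<and> x \<in> X n \<and>
      (\<forall>z\<in>X (Suc n). {z, y} \<in> edges G) \<and> {x, y} \<notin> edges G" for n
  proof -
    obtain x where x: "x \<in> X n" "x \<notin> X (Suc n)"
      using 2(2)[of n "Suc n"] by blast
    moreover have "x \<in> verts G"
      using x(1) 2(1) unfolding neighborhood_lattice_def by blast
    moreover obtain y where "y \<in> verts G" "\<And>z. z \<in> X (Suc n) \<Longrightarrow> {z, y} \<in> edges G"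
        "{x, y} \<notin> edges G"
      using neighborhood_lattice_separate[of "X (Suc n)" G x] 2(1) x(2) \<open>x \<in> verts G\<close> by blast
    ultimately show ?thesis
      by blast
  qed
  then obtain x y where xy: "\<And>n. x n \<in> verts G \<and> y n \<in> verts G \<and> x n \<in> X n \<and>
      (\<forall>z\<in>X (Suc n). {z, y n} \<in> edges G) \<and> {x n, y n} \<notin> edges G"
    by metis
  \<comment> \<open>Now the later vertex \<open>x n\<close> lies in \<open>X n\<close>, a subset of
    \<open>X (Suc m)\<close>, so it is adjacent to the earlier \<open>y m\<close>; hence the
    exchange of \<open>x\<close> and \<open>y\<close> at the end.\<close>
  have "{y m, x n} \<in> edges G" if "m < n" for m n
  proof -
    have "X n \<subseteq> X (Suc m)"
      using 2(2)[of "Suc m" n] that by (cases "Suc m = n") auto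
    then show ?thesis
      using xy[of m] xy[of n] by (auto simp: insert_commute)
  qed
  then show thesis
    using that[of y x] xy by (auto simp: insert_commute)
qed

text \<open>Ramsey is applied to adjacency: pairwise adjacent terms would form an infinite clique,
  because \<open>x\<close> is injective.\<close>

lemma independent_subsequence:
  fixes x :: "nat \<Rightarrow> 'a"
  assumes "\<not> (\<exists>K. clique G K \<and> infinite K)" and "simple_graph G"
    and "inj x" and "range x \<subseteq> verts G"
  obtains r :: "nat \<Rightarrow> nat" where "strict_mono r" and "\<And>m n. {x (r m), x (r n)} \<notin> edges G"
proof -
  obtain r :: "nat \<Rightarrow> nat" where r: "strict_mono r"
    and hom: "(\<forall>m n. m < n \<longrightarrow> {x (r m), x (r n)} \<in> edges G) \<or>
      (\<forall>m n. m < n \<longrightarrow> {x (r m), x (r n)} \<notin> edges G)"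
    by (rule Ramsey_subsequence)
  have "\<not> (\<forall>m n. m < n \<longrightarrow> {x (r m), x (r n)} \<in> edges G)"
  proof
    assume adj: "\<forall>m n. m < n \<longrightarrow> {x (r m), x (r n)} \<in> edges G"
    have "{x (r m), x (r n)} \<in> edges G" if "x (r m) \<noteq> x (r n)" for m n
    proof (cases m n rule: linorder_cases)
      case greater
      then show ?thesis
        using adj by (subst insert_commute) blast
    qed (use that adj in simp_all)
    then have "clique G (range (x \<circ> r))"
      using assms(4) by (auto simp: clique_def)
    moreover have "infinite (range (x \<circ> r))"
      using assms(3) r by (intro range_inj_infinite inj_compose strict_mono_imp_inj_on)
    ultimately show False
      using assms(1) by blast
  qed
  with hom have less: "m < n \<Longrightarrow> {x (r m), x (r n)} \<notin> edges G" for m n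
    by blast
  \<comment> \<open>For equal indices the pair collapses to a singleton, which is never an edge of a
    simple graph.\<close>
  have diag: "{x (r n), x (r n)} \<notin> edges G" for n
    using assms(2) by (auto simp: simple_graph_def doubleton_eq_iff)
  have "{x (r m), x (r n)} \<notin> edges G" for m n
  proof (cases m n rule: linorder_cases)
    case greater
    then show ?thesis
      by (subst insert_commute) (rule less)
  qed (use less diag in blast)+
  then show thesis
    by (rule that[OF r])
qed

lemma half_graph_has_induced_copy:
  fixes x y :: "nat \<Rightarrow> 'a"
  assumes "simple_graph G" and "\<not> (\<exists>K. clique G K \<and> infinite K)"
    and "range x \<subseteq> verts G" and "range y \<subseteq> verts G"
    and less: "\<And>m n. m < n \<Longrightarrow> {x m, y n} \<in> edges G" and diag: "\<And>n. {x n, y n} \<notin> edges G"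
  shows "has_induced_copy G G0 \<or> has_induced_copy G G1"
proof -
  \<comment> \<open>Equality of \<open>x m\<close> and \<open>x n\<close> would contradict
    \<open>diag\<close> at \<open>n\<close>, equality of \<open>y m\<close> and \<open>y n\<close>
    would contradict it at \<open>m\<close>.\<close>
  have "x m \<noteq> x n" "y m \<noteq> y n" if "m < n" for m n
    using less[OF that] diag[of m] diag[of n] by auto
  then have "inj x" "inj y"
    by (simp_all add: linorder_injI)
  \<comment> \<open>Three successive refinements: \<open>r\<close> makes the \<open>x\<close>
    independent, \<open>s\<close> the \<open>y\<close>, and \<open>t\<close> makes the adjacency of
    later \<open>x\<close> to earlier \<open>y\<close> constant. Each property passes to further
    subsequences.\<close>
  then obtain r :: "nat \<Rightarrow> nat" where r: "strict_mono r" "\<And>m n. {x (r m), x (r n)} \<notin> edges G"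
    using independent_subsequence[OF assms(2,1) _ assms(3)] by blast
  have "inj (y \<circ> r)" "range (y \<circ> r) \<subseteq> verts G"
    using \<open>inj y\<close> r(1) assms(4) by (auto intro: inj_compose strict_mono_imp_inj_on)
  then obtain s :: "nat \<Rightarrow> nat" where s: "strict_mono s" "\<And>m n. {y (r (s m)), y (r (s n))} \<notin> edges G"
    using independent_subsequence[OF assms(2,1)] unfolding comp_def by blast
  obtain t :: "nat \<Rightarrow> nat" where t: "strict_mono t"
    and hom: "(\<forall>m n. m < n \<longrightarrow> {x (r (s (t n))), y (r (s (t m)))} \<in> edges G) \<or>
      (\<forall>m n. m < n \<longrightarrow> {x (r (s (t n))), y (r (s (t m)))} \<notin> edges G)"
    by (rule Ramsey_subsequence)
  define q where "q = r \<circ> s \<circ> t"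
  have q: "strict_mono q"
    using r(1) s(1) t by (simp add: q_def strict_mono_def)
  define a where "a = x \<circ> q"
  define b where "b = y \<circ> q"
  have ab: "range a \<subseteq> verts G" "range b \<subseteq> verts G" "inj a" "inj b"
    using assms(3,4) \<open>inj x\<close> \<open>inj y\<close> q
    by (auto simp: a_def b_def intro: inj_compose strict_mono_imp_inj_on)
  have indep: "{a m, a n} \<notin> edges G" "{b m, b n} \<notin> edges G" for m n
    using r(2) s(2) by (auto simp: a_def b_def q_def)
  have a_less_b: "m < n \<Longrightarrow> {a m, b n} \<in> edges G" for m n
    using less q by (auto simp: a_def b_def strict_mono_def)
  have a_b: "{a n, b n} \<notin> edges G" for n
    using diag by (simp add: a_def b_def)
  \<comment> \<open>The vertex \<open>a m\<close> has the neighbor \<open>b (Suc m)\<close>, whereas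
    \<open>b n\<close> is adjacent to no \<open>b\<close>.\<close>
  have neq: "a m \<noteq> b n" for m n
    using a_less_b[of m "Suc m"] indep(2)[of n "Suc m"] by auto
  show ?thesis
  proof (cases "\<forall>m n. m < n \<longrightarrow> {a n, b m} \<in> edges G")
    case True
    then have "{a i, b j} \<in> edges G \<longleftrightarrow> i \<noteq> j" for i j
      using a_less_b a_b by (metis nat_neq_iff)
    then have "has_induced_copy G G0"
      unfolding G0_eq_bipartite_graph
      using ab indep neq by (intro has_induced_copy_bipartite_graphI)
    then show ?thesis ..
  next
    case False
    then have "m < n \<Longrightarrow> {a n, b m} \<notin> edges G" for m n
      using hom unfolding a_def b_def q_def by auto
    \<comment> \<open>Here \<open>a i\<close> and \<open>b j\<close> are adjacent exactly when
      \<open>i < j\<close>; the shift by \<open>Suc\<close> turns this into \<le>.\<close>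
    then have iff: "{a i, b (Suc j)} \<in> edges G \<longleftrightarrow> i \<le> j" for i j
      using a_less_b[of i "Suc j"] a_b[of i] by (metis less_Suc_eq_le nat_neq_iff)
    have "has_induced_copy G G1"
      unfolding G1_eq_bipartite_graph
    proof (rule has_induced_copy_bipartite_graphI[where a = a and b = "b \<circ> Suc"])
      show "inj (b \<circ> Suc)"
        using ab(4) by (simp add: inj_compose)
    qed (use ab indep neq iff in auto)
    then show ?thesis ..
  qed
qed

theorem theorem7:
  fixes G :: "'a ugraph"
  assumes "simple_graph G"
    and "\<not> (\<exists>K. clique G K \<and> infinite K)"
  shows "(\<exists>C \<in> chains (neighborhood_lattice G). infinite C)
     \<longleftrightarrow> has_induced_copy G G0 \<or> has_induced_copy G G1"
proof
  assume "\<exists>C \<in> chains (neighborhood_lattice G). infinite C"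
  then obtain C where C: "C \<in> chains (neighborhood_lattice G)" "infinite C"
    by blast
  show "has_induced_copy G G0 \<or> has_induced_copy G G1"
    by (rule infinite_chain_half_graph[OF C], rule half_graph_has_induced_copy[OF assms])
next
  assume "has_induced_copy G G0 \<or> has_induced_copy G G1"
  then show "\<exists>C \<in> chains (neighborhood_lattice G). infinite C"
  proof
    assume "has_induced_copy G G0"
    \<comment> \<open>The index required by \<open>not_R\<close> is \<open>n\<close> itself.\<close>
    then show ?thesis
      unfolding G0_eq_bipartite_graph by (rule infinite_chain_of_bipartite_graph) auto
  next
    assume "has_induced_copy G G1"
    \<comment> \<open>Here \<open>n\<close> is related to itself, and the required index is
      \<open>n + 1\<close>; this is why \<open>not_R\<close> allows indices up to
      \<open>n + 1\<close>.\<close>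
    then show ?thesis
      unfolding G1_eq_bipartite_graph
      by (rule infinite_chain_of_bipartite_graph) (auto simp: less_Suc_eq)
  qed
qed

end
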